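(* Let $d$ be an arbitrary design on $N$ units with $0<\pi_i<1$ for all $i$, let $c_i=(1-\pi_i)Y_i(1)+\pi_iY_i(0)$, $\bm{c}=(c_1,\dots,c_N)^\top$, and let $\hat{\bm{c}}=(\hat c_1,\dots,\hat c_N)^\top$ be any unbiased estimator of $\bm{c}$, i.e. $\mathbb{E}_d(\hat{\bm{c}})=\bm{c}$. Then the direct imputation variance estimator $\psi(\hat{\bm{c}})$ is conservative: $$\mathbb{E}_d\{\psi(\hat{\bm{c}})\}\ge\mathrm{Var}_d(\hat\tau).$$
   Context: There are $N$ units with fixed real potential outcomes $Y_i(0),Y_i(1)$. A design $d$ is a probability distribution of the random assignment $\bm{W}\in\{0,1\}^N$; $p_{\bm{w}}=\Pr_d(\bm{W}=\bm{w})$, $\pi_i=\Pr_d(W_i=1)$; $\mathbb{E}_d,\mathrm{Var}_d$ are over $\bm{W}$ only. $Y_i^{\text{obs}}=W_iY_i(1)+(1-W_i)Y_i(0)$, and $\hat\tau=\frac1N\sum_iW_iY_i^{\text{obs}}/\pi_i-\frac1N\sum_i(1-W_i)Y_i^{\text{obs}}/(1-\pi_i)$ is the Horvitz–Thompson estimator. An estimator is a function of $\bm{W}$ and the observed outcomes. For $\bm{x}\in\mathbb{R}^N$, $$\psi(\bm{x})=\frac1{N^2}\sum_{\bm{w}}p_{\bm{w}}\Big(\sum_{i:w_i=1}\frac{x_i}{\pi_i}-\sum_{i:w_i=0}\frac{x_i}{1-\pi_i}\Big)^2 .$$ *)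

theory Defs
  imports "HOL-Probability.Probability"
begin

text \<open>
  Units are the elements of a finite type \<open>'n\<close>, so \<open>N = CARD('n)\<close> (hence \<open>N \<ge> 1\<close>).
  An assignment is a vector \<open>w :: bool ^ 'n\<close>, with \<open>w $ i\<close> standing for \<open>W\<^sub>i = 1\<close>.
  A design may have any support, and expectations over it are finite sums because
  the type of assignments is finite.
\<close>

type_synonym 'n assignment = "bool ^ 'n"
type_synonym 'n design = "(bool ^ 'n) pmf"

text \<open>An estimator of an \<open>'a\<close>-valued estimand sees only the assignment and the observed outcomes.\<close>

type_synonym ('n, 'a) estimator = "bool ^ 'n \<Rightarrow> real ^ 'n \<Rightarrow> 'a"

definition treat_prob :: "('n::finite) design \<Rightarrow> 'n \<Rightarrow> real" where
  "treat_prob d i = measure_pmf.prob d {w. w $ i}"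

definition observed :: "real ^ 'n \<Rightarrow> real ^ 'n \<Rightarrow> ('n::finite) assignment \<Rightarrow> real ^ 'n" where
  "observed Y0 Y1 w = (\<chi> i. of_bool (w $ i) * Y1 $ i + (1 - of_bool (w $ i)) * Y0 $ i)"

definition horvitz_thompson :: "('n::finite) design \<Rightarrow> ('n, real) estimator" where
  "horvitz_thompson d w y =
     1 / real CARD('n) * (\<Sum>i\<in>UNIV. of_bool (w $ i) * y $ i / treat_prob d i)
   - 1 / real CARD('n) * (\<Sum>i\<in>UNIV. (1 - of_bool (w $ i)) * y $ i / (1 - treat_prob d i))"

definition imputation_target ::
    "('n::finite) design \<Rightarrow> real ^ 'n \<Rightarrow> real ^ 'n \<Rightarrow> real ^ 'n" where
  "imputation_target d Y0 Y1 =
     (\<chi> i. (1 - treat_prob d i) * Y1 $ i + treat_prob d i * Y0 $ i)"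

definition psi :: "('n::finite) design \<Rightarrow> real ^ 'n \<Rightarrow> real" where
  "psi d x =
     1 / (real CARD('n))\<^sup>2 *
       (\<Sum>w\<in>UNIV. pmf d w *
          ((\<Sum>i | w $ i. x $ i / treat_prob d i)
         - (\<Sum>i | \<not> w $ i. x $ i / (1 - treat_prob d i)))\<^sup>2)"

text \<open>
  Unbiasedness at the given potential outcomes \<open>Y0\<close>, \<open>Y1\<close>, which are fixed; an estimator that is
  unbiased for all potential outcomes is in particular unbiased at the given ones.
\<close>

definition unbiased ::
    "('n::finite) design \<Rightarrow> real ^ 'n \<Rightarrow> real ^ 'n \<Rightarrow> ('n, real ^ 'n) estimator \<Rightarrow> real ^ 'n \<Rightarrow> bool" where
  "unbiased d Y0 Y1 est \<theta> \<longleftrightarrow>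
     measure_pmf.expectation d (\<lambda>w. est w (observed Y0 Y1 w)) = \<theta>"

end

theory Submission
  imports Defs
begin

text \<open>
  Up to the additive constant \<open>\<tau>\<close>, the Horvitz--Thompson estimator is \<open>1/N\<close> times the contrast
  of \<open>c\<close>, so its variance is at most the second moment \<open>\<psi>(c)\<close> of the latter. As \<open>\<psi>\<close> is a
  nonnegative combination of squares of linear forms, \<open>\<psi>(c) = \<psi>(E c_hat) \<le> E \<psi>(c_hat)\<close> by Jensen.
\<close>

text \<open>The two arms are merged into one signed sum over all units, so that linearity in
  \<open>x\<close> can be read off from the form.\<close>

definition contrast :: "('n::finite) design \<Rightarrow> 'n assignment \<Rightarrow> real ^ 'n \<Rightarrow> real" where
  "contrast d w x =
     (\<Sum>i\<in>UNIV. (if w $ i then 1 / treat_prob d i else - 1 / (1 - treat_prob d i)) * x $ i)"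

lemma bounded_linear_contrast: "bounded_linear (contrast d w)"
  unfolding contrast_def
  by (intro bounded_linear_sum bounded_linear_compose[OF bounded_linear_mult_right]
      bounded_linear_vec_nth)

lemma psi_eq_contrast:
  "psi d x = measure_pmf.expectation d (\<lambda>w. (contrast d w x / real CARD('n))\<^sup>2)"
  for d :: "('n::finite) design"
proof -
  have "(\<Sum>i | w $ i. x $ i / treat_prob d i) - (\<Sum>i | \<not> w $ i. x $ i / (1 - treat_prob d i))
      = contrast d w x" for w
  proof -
    have "contrast d w x = (\<Sum>i\<in>UNIV. if w $ i then x $ i / treat_prob d i
        else - (x $ i / (1 - treat_prob d i)))"
      unfolding contrast_def by (rule sum.cong) auto
    then show ?thesis
      by (simp add: sum.If_cases sum_negf Collect_neg_eq)
  qed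
  then show ?thesis
    by (simp add: psi_def integral_measure_pmf_real[of UNIV] sum_divide_distrib power_divide mult_ac)
qed

lemma (in prob_space) power2_expectation_le:
  fixes X :: "'a \<Rightarrow> real"
  assumes "integrable M X" "integrable M (\<lambda>x. (X x)\<^sup>2)"
  shows "(expectation X)\<^sup>2 \<le> expectation (\<lambda>x. (X x)\<^sup>2)"
  using variance_eq[OF assms] variance_positive[of X] by simp

text \<open>Shifting by \<open>a\<close> does not change the variance, and a variance is a second
  moment minus a squared mean.\<close>

lemma variance_le_expectation_square_diff:
  fixes f :: "'a::finite \<Rightarrow> real"
  shows "measure_pmf.variance p f \<le> measure_pmf.expectation p (\<lambda>x. (f x - a)\<^sup>2)"
proof -
  have int: "integrable p g" for g :: "'a \<Rightarrow> real"
    by (simp add: integrable_measure_pmf_finite)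
  have "measure_pmf.variance p f = measure_pmf.variance p (\<lambda>x. f x - a)"
    by (simp add: int)
  also have "\<dots> \<le> measure_pmf.expectation p (\<lambda>x. (f x - a)\<^sup>2)"
    by (subst measure_pmf.variance_eq) (simp_all add: int)
  finally show ?thesis .
qed

text \<open>The assignment averaged over inside \<open>psi\<close> is separate from the randomness
  of \<open>X\<close>; keeping \<open>p\<close> apart from \<open>d\<close> makes this
  visible.\<close>

lemma psi_expectation_le:
  fixes d :: "('n::finite) design" and p :: "('a::finite) pmf" and X :: "'a \<Rightarrow> real ^ 'n"
  shows "psi d (measure_pmf.expectation p X) \<le> measure_pmf.expectation p (\<lambda>x. psi d (X x))"
proof -
  have int: "integrable p g" for g :: "'a \<Rightarrow> 'b::{banach, second_countable_topology}"
    by (simp add: integrable_measure_pmf_finite)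
  \<comment> \<open>For fixed \<open>w\<close> the contrast is linear and commutes with the
    expectation of \<open>X\<close>, so the claim is that a variance is nonnegative.\<close>
  have "(contrast d w (measure_pmf.expectation p X) / real CARD('n))\<^sup>2
      \<le> measure_pmf.expectation p (\<lambda>x. (contrast d w (X x) / real CARD('n))\<^sup>2)" for w
    using measure_pmf.power2_expectation_le[OF int int,
        of "\<lambda>x. contrast d w (X x) / real CARD('n)"]
    by (simp add: integral_bounded_linear[OF bounded_linear_contrast int])
  then have "psi d (measure_pmf.expectation p X)
      \<le> measure_pmf.expectation d (\<lambda>w.
          measure_pmf.expectation p (\<lambda>x. (contrast d w (X x) / real CARD('n))\<^sup>2))"
    unfolding psi_eq_contrast
    by (intro integral_mono integrable_measure_pmf_finite) simp_all
  also have "\<dots> = measure_pmf.expectation p (\<lambda>x. psi d (X x))"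
    unfolding psi_eq_contrast integral_measure_pmf_real[of UNIV, OF finite UNIV_I]
    by (simp add: sum_distrib_left sum_distrib_right mult_ac) (rule sum.swap)
  finally show ?thesis .
qed

text \<open>The weights in \<open>imputation_target\<close> are exactly those for which the
  remainder of unit \<open>i\<close> is \<open>Y1 $ i - Y0 $ i\<close> in both arms, hence free of
  \<open>w\<close>.\<close>

lemma horvitz_thompson_eq_contrast:
  fixes d :: "('n::finite) design"
  assumes "\<And>i. 0 < treat_prob d i \<and> treat_prob d i < 1"
  shows "horvitz_thompson d w (observed Y0 Y1 w) =
    contrast d w (imputation_target d Y0 Y1) / real CARD('n)
      + (\<Sum>i\<in>UNIV. Y1 $ i - Y0 $ i) / real CARD('n)"
proof -
  have "of_bool (w $ i) * observed Y0 Y1 w $ i / treat_prob d i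
      - (1 - of_bool (w $ i)) * observed Y0 Y1 w $ i / (1 - treat_prob d i)
      = (if w $ i then 1 / treat_prob d i else - 1 / (1 - treat_prob d i))
          * imputation_target d Y0 Y1 $ i + (Y1 $ i - Y0 $ i)" for i
  proof -
    have "treat_prob d i \<noteq> 0" "1 - treat_prob d i \<noteq> 0"
      using assms[of i] by auto
    then show ?thesis
      by (cases "w $ i") (simp_all add: observed_def imputation_target_def divide_simps,
          simp_all add: algebra_simps)
  qed
  then show ?thesis
    by (simp add: horvitz_thompson_def contrast_def flip: sum_subtractf sum.distrib
        right_diff_distrib diff_divide_distrib add_divide_distrib)
qed

theorem mainTheorem11:
  fixes d :: "('n::finite) design"
    and Y0 Y1 :: "real ^ 'n"
    and c_hat :: "('n, real ^ 'n) estimator"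
  assumes "\<And>i. 0 < treat_prob d i \<and> treat_prob d i < 1"
    and "unbiased d Y0 Y1 c_hat (imputation_target d Y0 Y1)"
  shows "measure_pmf.expectation d (\<lambda>w. psi d (c_hat w (observed Y0 Y1 w)))
       \<ge> measure_pmf.variance d (\<lambda>w. horvitz_thompson d w (observed Y0 Y1 w))"
proof -
  \<comment> \<open>The shift is the average treatment effect; what remains is the scaled contrast
    of the target, whose second moment is \<open>psi\<close>.\<close>
  have "measure_pmf.variance d (\<lambda>w. horvitz_thompson d w (observed Y0 Y1 w))
      \<le> psi d (imputation_target d Y0 Y1)"
    using variance_le_expectation_square_diff[of d
        "\<lambda>w. horvitz_thompson d w (observed Y0 Y1 w)"
        "(\<Sum>i\<in>UNIV. Y1 $ i - Y0 $ i) / real CARD('n)"]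
    by (simp add: horvitz_thompson_eq_contrast[OF assms(1)] psi_eq_contrast)
  \<comment> \<open>Jensen with \<open>d\<close> in both roles: the assignment behind
    \<open>c_hat\<close> and the one summed over in \<open>psi\<close> are distinct variables with
    the same law.\<close>
  also have "\<dots> \<le> measure_pmf.expectation d (\<lambda>w. psi d (c_hat w (observed Y0 Y1 w)))"
    using psi_expectation_le[of d d "\<lambda>w. c_hat w (observed Y0 Y1 w)"] assms(2)
    by (simp add: unbiased_def)
  finally show ?thesis .
qed

end
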